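(* Let $h\in\mathbb{N}$, let $w \in \mathcal{W}_h$ and let $v = (\alpha_1,\beta_1,\gamma_1,\ldots,\alpha_h,\beta_h,\gamma_h,\delta) = \textsc{Canonicalise}(w)$. Let $r = \operatorname{rank}(w)$. Then the functional equivalence class $\mathfrak{F}[w] \subset \mathcal{W}_h$ is a union of subsets $$\mathfrak{F}[w] = \bigcup_{(\sigma,\tau)\in\Gamma(h,r)} \left( X^{\delta}_{\tau^{-1}[0]} \cap \bigcap_{i=1}^{r} Y^{\alpha_i,\beta_i,\gamma_i}_{\sigma,\tau^{-1}[i]} \cap \bigcap_{i=r+1}^{h} Z_{\sigma,\tau^{-1}[i]} \right)$$ where $\Gamma(h,r)$ denotes the set of all canonicalisation traces of order $r$ on $h$ units and, for $I\subseteq\{1,\ldots,h\}$, $\sigma\in\{-1,+1\}^h$ and $\alpha,\beta,\gamma,\delta\in\mathbb{R}$, $$X^{\delta}_{I} = \left\{ (a_1,b_1,c_1,\ldots,a_h,b_h,c_h,d)\in\mathcal{W}_h \;\middle|\; \forall i\in I,\ b_i=0, \text{ and } d+\sum_{i\in I}a_i\tanh(c_i)=\delta \right\},$$ $$Y^{\alpha,\beta,\gamma}_{\sigma,I} = \left\{ (a_1,b_1,c_1,\ldots,a_h,b_h,c_h,d)\in\mathcal{W}_h \;\middle|\; \forall i\in I,\ \sigma_i\cdot(b_i,c_i)=(\beta,\gamma), \text{ and } \sum_{i\in I}\sigma_i a_i=\alpha \right\},$$ $$Z_{\sigma,I} = \left\{ (a_1,b_1,c_1,\ldots,a_h,b_h,c_h,d)\in\mathcal{W}_h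 \;\middle|\; \forall i,j\in I,\ \sigma_i\cdot(b_i,c_i)=\sigma_j\cdot(b_j,c_j), \text{ and } \sum_{i\in I}\sigma_i a_i=0 \right\}.$$
   Context: For $h \in \mathbb{N}$ (including $h=0$) let $\mathcal{W}_h = \mathbb{R}^{3h+1}$, with elements (parameters) written $w = (a_1,b_1,c_1,\ldots,a_h,b_h,c_h,d)$, where $a_i,b_i,c_i,d\in\mathbb{R}$; the triple $(a_i,b_i,c_i)$ is called (hidden) unit $i$. Each $w\in\mathcal{W}_h$ defines $f_w:\mathbb{R}\to\mathbb{R}$ by $f_w(x) = d + \sum_{i=1}^h a_i\tanh(b_i x + c_i)$. The functional equivalence class of $w\in\mathcal{W}_h$ is $\mathfrak{F}[w]=\{w'\in\mathcal{W}_h \mid f_w=f_{w'}\}$. The rank of $w\in\mathcal{W}_h$ is $\operatorname{rank}(w)=\min\{h'\in\mathbb{N} \mid \exists w'\in\mathcal{W}_{h'},\ f_w=f_{w'}\}$. Canonicalisation trace: for $r,h\in\mathbb{N}$ with $r\le h$, a canonicalisation trace of order $r$ on $h$ units is a tuple $(\sigma,\tau)$ where $\sigma\in\{-1,+1\}^h$ is a sign vector and $\tau:\{1,\ldots,h\}\to\{0,1,\ldots,h\}$ is a function whose range includes $\{1,\ldots,r\}$. For $j\in\{0,\ldots,h\}$, $\tau^{-1}[j]=\{i \mid \tau(i)=j\}$ is the preimage of $j$ (possibly empty). Empty sums are $0$. The procedure $\textsc{Canonicalise}$ takes $w=(a_1,b_1,c_1,\ldots,a_h,b_h,c_h,d)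 \in \mathcal{W}_h$, modifies its components, and returns the resulting element of $\mathcal{W}_h$, as follows. Stage 1 (reduction). Set $Z \gets \emptyset$. While at least one of the following four conditions holds, perform the action of the first condition in the list that holds (for some choice of units witnessing it): (1) if for some unit $i\notin Z$, $a_i=0$: set $b_i,c_i\gets 0$ and $Z\gets Z\cup\{i\}$; (2) else if for some unit $i\notin Z$, $b_i=0$: set $d\gets d+a_i\tanh(c_i)$, then $a_i,c_i\gets 0$, and $Z\gets Z\cup\{i\}$; (3) else if for some units $i,j\notin Z$, $i\ne j$, $(b_i,c_i)=(b_j,c_j)$: set $a_j\gets a_j+a_i$, then $a_i,b_i,c_i\gets 0$, and $Z\gets Z\cup\{i\}$; (4) else if for some units $i,j\notin Z$, $i\neq j$, $(b_i,c_i)=(-b_j,-c_j)$: set $a_j\gets a_j-a_i$, then $a_i,b_i,c_i\gets 0$, and $Z\gets Z\cup\{i\}$. Stage 2 (negation). For each unit $i\notin Z$, set $(a_i,b_i,c_i)\gets \operatorname{sign}(b_i)\cdot(a_i,b_i,c_i)$. Stage 3 (sorting). Let $\pi$ be a permutation of $\{1,\ldots,h\}$ sorting the units by decreasing $b_i$, breaking ties by decreasing $c_i$. Set $w\gets(a_{\pi(1)},b_{\pi(1)},c_{\pi(1)},\ldots,a_{\pi(h)},b_{\pi(h)},c_{\pi(h)},d)$ and return $w$. $\textsc{Canonicalise}(w)$ denotes the output of an execution of this procedure on $w$; the procedure does not prescribe which witnessing units are picked in Stage 1 or which sorting permutation is picked in Stage 3. (The set $Z$ of units in the procedure is unrelated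 to the sets $Z_{\sigma,I}$ in the claim.) *)

theory Defs
  imports Complex_Main "HOL-Library.FuncSet" "HOL-Combinatorics.Permutations"
begin

text \<open>
  A parameter \<open>(a\<^sub>1, b\<^sub>1, c\<^sub>1, \<dots>, a\<^sub>h, b\<^sub>h, c\<^sub>h, d)\<close> is a record of three functions of the
  unit index and the output bias. Units are numbered from 1 to \<open>h\<close>; requiring the functions
  to be extensional on \<open>{1..h}\<close> makes \<open>param_space h\<close> a copy of $R^{3h+1}$, so that equality of
  records is equality of parameters. The number of units is not stored in the record.
\<close>

record param =
  pa :: "nat \<Rightarrow> real"
  pb :: "nat \<Rightarrow> real"
  pc :: "nat \<Rightarrow> real"
  pd :: real

definition param_space :: "nat \<Rightarrow> param set" where
  "param_space h = {w. pa w \<in> extensional {1..h} \<and> pb w \<in> extensional {1..h} \<and>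
                       pc w \<in> extensional {1..h}}"

definition nn_fun :: "nat \<Rightarrow> param \<Rightarrow> real \<Rightarrow> real" where
  "nn_fun h w x = pd w + (\<Sum>i = 1..h. pa w i * tanh (pb w i * x + pc w i))"

definition fun_equiv_class :: "nat \<Rightarrow> param \<Rightarrow> param set" where
  "fun_equiv_class h w = {w' \<in> param_space h. nn_fun h w = nn_fun h w'}"

definition nn_rank :: "nat \<Rightarrow> param \<Rightarrow> nat" where
  "nn_rank h w = (LEAST h'. \<exists>w' \<in> param_space h'. nn_fun h w = nn_fun h' w')"


subsection \<open>The canonicalisation procedure\<close>

text \<open>
  The four conditions of the reduction stage, each with the units that witness it;
  \<open>Z\<close> is the set of units already eliminated.
\<close>

definition zero_out :: "nat \<Rightarrow> param \<Rightarrow> nat set \<Rightarrow> nat \<Rightarrow> bool" where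
  "zero_out h w Z i \<longleftrightarrow> i \<in> {1..h} - Z \<and> pa w i = 0"

definition zero_in :: "nat \<Rightarrow> param \<Rightarrow> nat set \<Rightarrow> nat \<Rightarrow> bool" where
  "zero_in h w Z i \<longleftrightarrow> i \<in> {1..h} - Z \<and> pb w i = 0"

definition equal_units :: "nat \<Rightarrow> param \<Rightarrow> nat set \<Rightarrow> nat \<Rightarrow> nat \<Rightarrow> bool" where
  "equal_units h w Z i j \<longleftrightarrow> i \<in> {1..h} - Z \<and> j \<in> {1..h} - Z \<and> i \<noteq> j \<and>
     (pb w i, pc w i) = (pb w j, pc w j)"

definition opposite_units :: "nat \<Rightarrow> param \<Rightarrow> nat set \<Rightarrow> nat \<Rightarrow> nat \<Rightarrow> bool" where
  "opposite_units h w Z i j \<longleftrightarrow> i \<in> {1..h} - Z \<and> j \<in> {1..h} - Z \<and> i \<noteq> j \<and>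
     (pb w i, pc w i) = (- pb w j, - pc w j)"

text \<open>
  One iteration of the loop, as a relation on states \<open>(w, Z)\<close>. The priority of the conditions
  is part of the rules; the choice of the witnessing units is left open. A step is possible
  exactly when one of the four conditions holds.
\<close>

inductive reduce_step :: "nat \<Rightarrow> param \<times> nat set \<Rightarrow> param \<times> nat set \<Rightarrow> bool" for h where
  drop_zero_out:
    "zero_out h w Z i \<Longrightarrow>
     reduce_step h (w, Z)
       (w\<lparr>pb := (pb w)(i := 0), pc := (pc w)(i := 0)\<rparr>, insert i Z)"
| drop_zero_in:
    "\<lbrakk>\<nexists>k. zero_out h w Z k; zero_in h w Z i\<rbrakk> \<Longrightarrow>
     reduce_step h (w, Z)
       (w\<lparr>pa := (pa w)(i := 0), pc := (pc w)(i := 0), pd := pd w + pa w i * tanh (pc w i)\<rparr>,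
        insert i Z)"
| merge_equal:
    "\<lbrakk>\<nexists>k. zero_out h w Z k; \<nexists>k. zero_in h w Z k; equal_units h w Z i j\<rbrakk> \<Longrightarrow>
     reduce_step h (w, Z)
       (w\<lparr>pa := (pa w)(j := pa w j + pa w i, i := 0), pb := (pb w)(i := 0),
          pc := (pc w)(i := 0)\<rparr>, insert i Z)"
| merge_opposite:
    "\<lbrakk>\<nexists>k. zero_out h w Z k; \<nexists>k. zero_in h w Z k; \<nexists>k l. equal_units h w Z k l;
      opposite_units h w Z i j\<rbrakk> \<Longrightarrow>
     reduce_step h (w, Z)
       (w\<lparr>pa := (pa w)(j := pa w j - pa w i, i := 0), pb := (pb w)(i := 0),
          pc := (pc w)(i := 0)\<rparr>, insert i Z)"

definition negate_units :: "nat \<Rightarrow> nat set \<Rightarrow> param \<Rightarrow> param" where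
  "negate_units h Z w =
     w\<lparr>pa := (\<lambda>i. if i \<in> {1..h} - Z then sgn (pb w i) * pa w i else pa w i),
       pb := (\<lambda>i. if i \<in> {1..h} - Z then sgn (pb w i) * pb w i else pb w i),
       pc := (\<lambda>i. if i \<in> {1..h} - Z then sgn (pb w i) * pc w i else pc w i)\<rparr>"

definition sorting_perm :: "nat \<Rightarrow> param \<Rightarrow> (nat \<Rightarrow> nat) \<Rightarrow> bool" where
  "sorting_perm h w \<pi> \<longleftrightarrow> \<pi> permutes {1..h} \<and>
     (\<forall>i \<in> {1..h}. \<forall>j \<in> {1..h}. i < j \<longrightarrow>
        pb w (\<pi> i) > pb w (\<pi> j) \<or>
        (pb w (\<pi> i) = pb w (\<pi> j) \<and> pc w (\<pi> i) \<ge> pc w (\<pi> j)))"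

definition permute_units :: "(nat \<Rightarrow> nat) \<Rightarrow> param \<Rightarrow> param" where
  "permute_units \<pi> w = w\<lparr>pa := pa w \<circ> \<pi>, pb := pb w \<circ> \<pi>, pc := pc w \<circ> \<pi>\<rparr>"

text \<open>
  \<open>canonicalise h w v\<close>: some execution of the procedure on \<open>w\<close>, with some choice of witnesses
  and of the sorting permutation, returns \<open>v\<close>.
\<close>

definition canonicalise :: "nat \<Rightarrow> param \<Rightarrow> param \<Rightarrow> bool" where
  "canonicalise h w v \<longleftrightarrow>
     (\<exists>w' Z \<pi>. (reduce_step h)\<^sup>*\<^sup>* (w, {}) (w', Z) \<and> (\<nexists>s. reduce_step h (w', Z) s) \<and>
        sorting_perm h (negate_units h Z w') \<pi> \<and>
        v = permute_units \<pi> (negate_units h Z w'))"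


subsection \<open>Canonicalisation traces and the sets they index\<close>

text \<open>\<open>r \<le> h\<close> follows from the condition on the range of \<open>\<tau>\<close>.\<close>

definition canon_traces :: "nat \<Rightarrow> nat \<Rightarrow> ((nat \<Rightarrow> real) \<times> (nat \<Rightarrow> nat)) set" where
  "canon_traces h r = {(\<sigma>, \<tau>). \<sigma> \<in> {1..h} \<rightarrow>\<^sub>E {-1, 1} \<and> \<tau> \<in> {1..h} \<rightarrow>\<^sub>E {0..h} \<and>
                               {1..r} \<subseteq> \<tau> ` {1..h}}"

definition trace_fibre :: "nat \<Rightarrow> (nat \<Rightarrow> nat) \<Rightarrow> nat \<Rightarrow> nat set" where
  "trace_fibre h \<tau> j = {i \<in> {1..h}. \<tau> i = j}"

definition X_set :: "nat \<Rightarrow> real \<Rightarrow> nat set \<Rightarrow> param set" where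
  "X_set h \<delta> I = {w \<in> param_space h.
     (\<forall>i \<in> I. pb w i = 0) \<and> pd w + (\<Sum>i \<in> I. pa w i * tanh (pc w i)) = \<delta>}"

definition Y_set :: "nat \<Rightarrow> real \<Rightarrow> real \<Rightarrow> real \<Rightarrow> (nat \<Rightarrow> real) \<Rightarrow> nat set \<Rightarrow> param set" where
  "Y_set h \<alpha> \<beta> \<gamma> \<sigma> I = {w \<in> param_space h.
     (\<forall>i \<in> I. (\<sigma> i * pb w i, \<sigma> i * pc w i) = (\<beta>, \<gamma>)) \<and> (\<Sum>i \<in> I. \<sigma> i * pa w i) = \<alpha>}"

definition Z_set :: "nat \<Rightarrow> (nat \<Rightarrow> real) \<Rightarrow> nat set \<Rightarrow> param set" where
  "Z_set h \<sigma> I = {w \<in> param_space h.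
     (\<forall>i \<in> I. \<forall>j \<in> I. (\<sigma> i * pb w i, \<sigma> i * pc w i) = (\<sigma> j * pb w j, \<sigma> j * pc w j)) \<and>
     (\<Sum>i \<in> I. \<sigma> i * pa w i) = 0}"

end

theory Submission imports Defs "HOL-Complex_Analysis.Conformal_Mappings" begin

text \<open>
  Flipping signs so that all input weights are positive, \<open>nn_fun h w\<close> is a constant plus a linear
  combination of functions \<open>tanh (\<beta> x + \<gamma>)\<close> with \<open>\<beta> > 0\<close>. These functions and the constant 1 are
  linearly independent: in a relation, pick a term with \<open>\<beta>\<close> maximal; its pole at
  \<open>(\<i> \<pi>/2 - \<gamma>)/\<beta>\<close> is on the boundary of the strip \<open>|Im z| < \<pi>/(2\<beta>)\<close>, where all terms are
  holomorphic, and no other term has that pole, so its coefficient vanishes. Hence the constant and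
  the coefficient of every pair \<open>(\<beta>, \<gamma>)\<close> are determined by the function, and the canonical form
  lists exactly the pairs with nonzero coefficient. A trace groups the units by their
  pair; groups whose coefficient cancels get indices above the rank, which is possible because
  there are at most \<open>h\<close> groups and those of the canonical form are all nonempty.
\<close>

section \<open>Linear independence of shifted and scaled tanh\<close>

lemma of_real_cosh: "of_real (cosh y) = (cosh (of_real y) :: complex)"
  and of_real_sinh: "of_real (sinh y) = (sinh (of_real y) :: complex)"
  by (simp_all add: cosh_def sinh_def scaleR_conv_of_real exp_of_real flip: of_real_minus)

lemma of_real_tanh: "of_real (tanh y) = (tanh (of_real y) :: complex)"
  by (simp add: tanh_def of_real_cosh of_real_sinh)

text \<open>The real and imaginary parts are \<open>cosh (Re u) * cos (Im u)\<close> and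
  \<open>sinh (Re u) * sin (Im u)\<close>. The factor \<open>cosh (Re u)\<close> never vanishes, and
  sine and cosine have no common zero. This locates the poles of tanh.\<close>

lemma cosh_eq_0_iff_complex:
  fixes u :: complex
  shows "cosh u = 0 \<longleftrightarrow> cos (Im u) = 0 \<and> Re u = 0"
proof -
  have pos: "exp (Re u) + exp (- Re u) \<noteq> 0"
    using exp_gt_zero[of "Re u"] exp_gt_zero[of "- Re u"] by linarith
  have "cosh u = 0 \<longleftrightarrow> cos (Im u) = 0 \<and> sin (Im u) * (exp (Re u) - exp (- Re u)) = 0"
    using pos by (auto simp: cosh_conv_cos complex_eq_iff Re_cos Im_cos add.commute)
  moreover have "sin (Im u) \<noteq> 0" if "cos (Im u) = 0"
    using that sin_cos_squared_add[of "Im u"] by auto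
  ultimately show ?thesis by auto
qed

text \<open>The imaginary part of the argument stays strictly between \<open>- pi / 2\<close> and
  \<open>pi / 2\<close>, where the cosine is positive.\<close>

lemma cosh_nonzero_strip:
  fixes \<beta> \<gamma> :: real and z :: complex
  assumes "0 \<le> \<beta>" "\<beta> * \<bar>Im z\<bar> < pi / 2"
  shows "cosh (of_real \<beta> * z + of_real \<gamma>) \<noteq> 0"
proof -
  have "\<bar>\<beta> * Im z\<bar> < pi / 2"
    using assms by (simp add: abs_mult)
  then have "cos (\<beta> * Im z) > 0"
    by (intro cos_gt_zero_pi) auto
  then show ?thesis
    by (simp add: cosh_eq_0_iff_complex)
qed

lemma tanh_independent:
  fixes A :: "real \<times> real \<Rightarrow> real"
  assumes fin: "finite P" and pos: "\<And>p. p \<in> P \<Longrightarrow> fst p > 0"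
    and eq: "\<And>x::real. d + (\<Sum>p\<in>P. A p * tanh (fst p * x + snd p)) = 0"
  shows "\<forall>p\<in>P. A p = 0" and "d = 0"
proof -
  show all0: "\<forall>p\<in>P. A p = 0"
  proof (rule ccontr)
    assume "\<not> (\<forall>p\<in>P. A p = 0)"
    \<comment> \<open>Terms with coefficient zero are discarded first: one of them could have a
      larger input weight, and a contradiction needs \<open>A p\<close> to be nonzero for the chosen
      \<open>p\<close>.\<close>
    define Q where "Q = {p\<in>P. A p \<noteq> 0}"
    have Q: "finite Q" "Q \<noteq> {}"
      using \<open>\<not> _\<close> fin by (auto simp: Q_def)
    have "Max (fst ` Q) \<in> fst ` Q"
      using Q by (intro Max_in) auto
    then obtain p where p: "p \<in> Q" "fst p = Max (fst ` Q)"
      by auto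
    obtain b c where bc: "p = (b, c)" by (cases p)
    have b: "b > 0" and max: "\<And>q. q \<in> Q \<Longrightarrow> fst q \<le> b"
      using p Q pos by (auto simp: bc Q_def)
    \<comment> \<open>the relation times the denominator of the term \<open>p\<close>, so that \<open>G\<close> is continuous at the pole of that term\<close>
    define G :: "complex \<Rightarrow> complex" where "G z =
       cosh (of_real b * z + of_real c) *
         (of_real d + (\<Sum>q\<in>Q - {p}. of_real (A q) * tanh (of_real (fst q) * z + of_real (snd q))))
       + of_real (A p) * sinh (of_real b * z + of_real c)" for z
    define S where "S = {z. - (pi / (2 * b)) < Im z} \<inter> {z. Im z < pi / (2 * b)}"
    have S: "open S" "connected S"
      unfolding S_def
      by (auto intro!: open_halfspace_Im_lt open_halfspace_Im_gt
            convex_connected convex_Int convex_halfspace_Im_lt convex_halfspace_Im_gt)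
    have nz: "cosh (of_real (fst q) * z + of_real (snd q)) \<noteq> 0" if "q \<in> Q" "z \<in> S" for q z
    proof (rule cosh_nonzero_strip)
      show "0 \<le> fst q"
        using that pos[of q] by (auto simp: Q_def)
      have "\<bar>Im z\<bar> < pi / (2 * b)"
        using that by (auto simp: S_def)
      then have "b * \<bar>Im z\<bar> < pi / 2"
        using b by (simp add: field_simps)
      moreover have "fst q * \<bar>Im z\<bar> \<le> b * \<bar>Im z\<bar>"
        using max[OF that(1)] by (intro mult_right_mono) auto
      ultimately show "fst q * \<bar>Im z\<bar> < pi / 2" by linarith
    qed
    have "G holomorphic_on S"
      unfolding G_def using nz
      by (intro analytic_imp_holomorphic analytic_intros) auto
    have Greal: "G z = 0" if "z \<in> \<real>" for z
    proof -
      obtain x where x: "z = of_real x" using \<open>z \<in> \<real>\<close> by (auto elim: Reals_cases)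
      have sumQ: "(\<Sum>q\<in>P. A q * tanh (fst q * x + snd q)) = (\<Sum>q\<in>Q. A q * tanh (fst q * x + snd q))"
        using fin by (intro sum.mono_neutral_right) (auto simp: Q_def)
      have t: "tanh (of_real (fst q) * z + of_real (snd q)) = of_real (tanh (fst q * x + snd q))" for q
        by (simp add: x flip: of_real_mult of_real_add of_real_tanh)
      have ch: "cosh (of_real b * z + of_real c) = of_real (cosh (b * x + c))"
        and sh: "sinh (of_real b * z + of_real c) = of_real (sinh (b * x + c))"
        by (simp_all add: x flip: of_real_mult of_real_add of_real_cosh of_real_sinh)
      have "G z = of_real (cosh (b * x + c) * (d + (\<Sum>q\<in>Q - {p}. A q * tanh (fst q * x + snd q)))
                 + A p * sinh (b * x + c))"
        unfolding G_def t ch sh by simp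
      also have "A p * sinh (b * x + c) = cosh (b * x + c) * (A p * tanh (fst p * x + snd p))"
        by (simp add: bc tanh_def)
      also have "cosh (b * x + c) * (d + (\<Sum>q\<in>Q - {p}. A q * tanh (fst q * x + snd q)))
            + cosh (b * x + c) * (A p * tanh (fst p * x + snd p))
          = cosh (b * x + c) * (d + (\<Sum>q\<in>Q. A q * tanh (fst q * x + snd q)))"
        using Q p by (simp add: sum.remove algebra_simps)
      also have "\<dots> = 0"
        using eq[of x] sumQ by simp
      finally show ?thesis by simp
    qed
    \<comment> \<open>\<open>G\<close> vanishes on the real line, which accumulates at 0 inside the
      connected open strip, so the identity theorem applies.\<close>
    have GS: "G z = 0" if "z \<in> S" for z
    proof (rule analytic_continuation[OF \<open>G holomorphic_on S\<close> S, of "\<real>" 0])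
      show "\<real> \<subseteq> S" "0 \<in> S" using b by (auto simp: S_def elim!: Reals_cases)
      show "(0::complex) islimpt \<real>"
        unfolding islimpt_approachable
      proof (intro allI impI)
        fix e :: real assume "e > 0"
        then show "\<exists>x'\<in>\<real>. x' \<noteq> (0::complex) \<and> dist x' 0 < e"
          by (intro bexI[of _ "of_real (e/2)"]) (auto simp: dist_norm)
      qed
    qed (use Greal that in auto)
    define z0 where "z0 = Complex (- c / b) (pi / (2 * b))"
    \<comment> \<open>Another term with input weight \<open>b\<close> has its poles on a different
      vertical line; a term with smaller input weight has its poles farther from the real
      axis.\<close>
    have nz0: "cosh (of_real (fst q) * z0 + of_real (snd q)) \<noteq> 0" if "q \<in> Q - {p}" for q
    proof (cases "fst q = b")
      case True
      then have "snd q \<noteq> c"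
        using that bc by (cases q) auto
      then show ?thesis
        using b True by (simp add: cosh_eq_0_iff_complex z0_def)
    next
      case False
      then have "fst q < b" "fst q > 0"
        using that max[of q] pos[of q] by (auto simp: Q_def)
      then show ?thesis
        using b by (intro cosh_nonzero_strip) (auto simp: z0_def field_simps)
    qed
    have arg: "of_real b * z0 + of_real c = \<i> * of_real (pi / 2)"
      using b by (simp add: z0_def complex_eq_iff)
    \<comment> \<open>\<open>z0\<close> is on the boundary of \<open>S\<close>, so
      \<open>G z0 = 0\<close> is obtained as a limit along the vertical segment below
      \<open>z0\<close>.\<close>
    have "isCont G z0"
      unfolding G_def using nz0 by (intro continuous_intros) auto
    moreover have "((\<lambda>t. Complex (- c / b) t) \<longlongrightarrow> z0) (at_left (pi / (2 * b)))"
      unfolding z0_def by (intro tendsto_intros)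
    ultimately have "((\<lambda>t. G (Complex (- c / b) t)) \<longlongrightarrow> G z0) (at_left (pi / (2 * b)))"
      by (rule isCont_tendsto_compose)
    moreover have "eventually (\<lambda>t. G (Complex (- c / b) t) = 0) (at_left (pi / (2 * b)))"
      using eventually_at_left_real[of 0 "pi / (2 * b)"] b
      by (auto elim!: eventually_mono intro!: GS simp: S_def)
    ultimately have "G z0 = 0"
      by (metis tendsto_eventually tendsto_unique trivial_limit_at_left_real)
    \<comment> \<open>At \<open>z0\<close> the factor cosh vanishes and kills all other terms, while
      \<open>sinh (\<i> * pi / 2) = \<i>\<close>.\<close>
    moreover have "G z0 = of_real (A p) * \<i>"
      unfolding G_def arg by (simp add: cosh_conv_cos sinh_conv_sin)
    ultimately show False
      using p by (simp add: Q_def)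
  qed
  show "d = 0"
    using eq[of 0] all0 by simp
qed

section \<open>Canonicalisation\<close>

text \<open>For the merging rules, which change two units but not their joint contribution.\<close>

lemma sum_cong_except_two:
  fixes f g :: "'a \<Rightarrow> real"
  assumes "finite S" "i \<in> S" "j \<in> S" "i \<noteq> j" "f i + f j = g i + g j"
    and "\<And>k. k \<in> S \<Longrightarrow> k \<noteq> i \<Longrightarrow> k \<noteq> j \<Longrightarrow> f k = g k"
  shows "sum f S = sum g S"
proof -
  have "S - {i} - {j} = S - {i, j}" by auto
  then have "sum F S = F i + F j + sum F (S - {i, j})" for F :: "'a \<Rightarrow> real"
    using assms(1-4) sum.remove[of S i F] sum.remove[of "S - {i}" j F] by simp
  moreover have "sum f (S - {i, j}) = sum g (S - {i, j})"
    using assms(6) by (intro sum.cong) auto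
  ultimately show ?thesis
    using assms(5) by simp
qed

text \<open>Oddness of tanh: a unit may be negated as a whole, by the procedure or by the sign
  vector of a trace.\<close>

lemma tanh_sign:
  fixes s a b c x :: real
  assumes "s \<in> {-1, 1}"
  shows "s * a * tanh (s * b * x + s * c) = a * tanh (b * x + c)"
proof -
  have "tanh (- (b * x) - c) = - tanh (b * x + c)"
    by (metis minus_add_distrib tanh_minus diff_conv_add_uminus)
  then show ?thesis
    using assms by auto
qed

lemma nn_fun_reduce_step:
  assumes "reduce_step h (w, Z) (w', Z')"
  shows "nn_fun h w' = nn_fun h w"
  using assms
proof cases
  case (drop_zero_out i)
  then show ?thesis
    by (auto simp: nn_fun_def zero_out_def fun_eq_iff intro!: sum.cong)
next
  case (drop_zero_in i)
  have "nn_fun h w' x = nn_fun h w x" for x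
  proof -
    have i: "i \<in> {1..h}" "pb w i = 0"
      using drop_zero_in by (auto simp: zero_in_def)
    have rest: "(\<Sum>k\<in>{1..h} - {i}. pa w' k * tanh (pb w' k * x + pc w' k))
        = (\<Sum>k\<in>{1..h} - {i}. pa w k * tanh (pb w k * x + pc w k))"
      by (intro sum.cong) (auto simp: drop_zero_in(1))
    show ?thesis
      unfolding nn_fun_def sum.remove[OF finite_atLeastAtMost i(1)] rest
      by (simp add: drop_zero_in(1) i(2))
  qed
  then show ?thesis by auto
next
  case (merge_equal i j)
  then show ?thesis
    by (auto simp: nn_fun_def equal_units_def fun_eq_iff algebra_simps
        intro!: sum_cong_except_two[of _ i j])
next
  case (merge_opposite i j)
  have "tanh (- pc w j - x * pb w j) = - tanh (pc w j + x * pb w j)" for x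
    by (metis minus_add_distrib tanh_minus diff_conv_add_uminus)
  with merge_opposite show ?thesis
    by (auto simp: nn_fun_def opposite_units_def fun_eq_iff algebra_simps
        intro!: sum_cong_except_two[of _ i j])
qed

text \<open>The rules change only units outside \<open>Z\<close>. The inserted unit ends up zero in
  all three components; where a rule resets only two of them, its guard says that the third is zero
  already.\<close>

lemma reduce_step_zeroed:
  assumes "reduce_step h (w, Z) (w', Z')" "\<forall>i\<in>Z. pa w i = 0 \<and> pb w i = 0 \<and> pc w i = 0"
  shows "\<forall>i\<in>Z'. pa w' i = 0 \<and> pb w' i = 0 \<and> pc w' i = 0"
  using assms
  by cases (auto simp: zero_out_def zero_in_def equal_units_def opposite_units_def)

lemma reduce_steps_invariant:
  assumes "(reduce_step h)\<^sup>*\<^sup>* (w, {}) (w', Z)"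
  shows "nn_fun h w' = nn_fun h w \<and> (\<forall>i\<in>Z. pa w' i = 0 \<and> pb w' i = 0 \<and> pc w' i = 0)"
  using assms
proof (induction rule: rtranclp_induct2)
  case refl
  show ?case by simp
next
  case (step w1 Z1 w2 Z2)
  then show ?case
    using nn_fun_reduce_step reduce_step_zeroed by metis
qed

text \<open>The conditions are refuted in order of priority, because the absence of the earlier ones
  is the guard of the next rule.\<close>

lemma reduce_step_terminal:
  assumes "\<nexists>s. reduce_step h (w, Z) s" "i \<in> {1..h} - Z"
  shows "pa w i \<noteq> 0" and "pb w i \<noteq> 0"
    and "\<And>j. j \<in> {1..h} - Z \<Longrightarrow> i \<noteq> j \<Longrightarrow>
      (pb w i, pc w i) \<noteq> (pb w j, pc w j) \<and> (pb w i, pc w i) \<noteq> (- pb w j, - pc w j)"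
proof -
  have 1: "\<nexists>k. zero_out h w Z k"
    using assms(1) drop_zero_out by metis
  have 2: "\<nexists>k. zero_in h w Z k"
    using assms(1) 1 drop_zero_in by metis
  have 3: "\<nexists>k l. equal_units h w Z k l"
    using assms(1) 1 2 merge_equal by metis
  have 4: "\<nexists>k l. opposite_units h w Z k l"
    using assms(1) 1 2 3 merge_opposite by metis
  show "pa w i \<noteq> 0" "pb w i \<noteq> 0"
    using 1 2 assms(2) by (auto simp: zero_out_def zero_in_def)
  show "(pb w i, pc w i) \<noteq> (pb w j, pc w j) \<and> (pb w i, pc w i) \<noteq> (- pb w j, - pc w j)"
    if "j \<in> {1..h} - Z" "i \<noteq> j" for j
    using 3 4 assms(2) that unfolding equal_units_def opposite_units_def by blast
qed

lemma nn_fun_negate_units: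
  assumes "\<And>i. i \<in> {1..h} - Z \<Longrightarrow> pb w i \<noteq> 0"
  shows "nn_fun h (negate_units h Z w) = nn_fun h w"
proof -
  have "sgn (pb w i) * pa w i * tanh (sgn (pb w i) * pb w i * x + sgn (pb w i) * pc w i)
      = pa w i * tanh (pb w i * x + pc w i)" if "i \<in> {1..h} - Z" for i x
    using assms[OF that] by (intro tanh_sign) (auto simp: sgn_real_def)
  then show ?thesis
    by (auto simp: nn_fun_def negate_units_def fun_eq_iff intro!: sum.cong)
qed

lemma nn_fun_permute_units:
  assumes "\<pi> permutes {1..h}"
  shows "nn_fun h (permute_units \<pi> w) = nn_fun h w"
proof
  fix x
  show "nn_fun h (permute_units \<pi> w) x = nn_fun h w x"
    using sum.permute[OF assms, of "\<lambda>i. pa w i * tanh (pb w i * x + pc w i)"]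
    by (simp add: nn_fun_def permute_units_def o_def)
qed

text \<open>What the later arguments use of the output of \<open>canonicalise\<close>, apart from
  its function. The number \<open>r\<close> turns out to be the rank
  (\<open>nn_rank_reduced\<close>).\<close>

definition reduced :: "nat \<Rightarrow> param \<Rightarrow> nat \<Rightarrow> bool" where
  "reduced h v r \<longleftrightarrow> r \<le> h \<and> (\<forall>i\<in>{1..r}. pa v i \<noteq> 0 \<and> pb v i > 0) \<and>
     inj_on (\<lambda>i. (pb v i, pc v i)) {1..r} \<and>
     (\<forall>i\<in>{r + 1..h}. pa v i = 0 \<and> pb v i = 0 \<and> pc v i = 0)"

lemma downward_closed_eq_atMost:
  fixes S :: "nat set"
  assumes "S \<subseteq> {1..h}" "\<And>i j. j \<in> S \<Longrightarrow> 1 \<le> i \<Longrightarrow> i < j \<Longrightarrow> i \<in> S"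
  shows "\<exists>r\<le>h. S = {1..r}"
proof (cases "S = {}")
  case True
  then show ?thesis by (intro exI[of _ 0]) auto
next
  case False
  have fin: "finite S" using assms(1) finite_subset by blast
  have "S = {1..Max S}"
  proof (intro set_eqI iffI)
    fix i assume "i \<in> {1..Max S}"
    then show "i \<in> S"
      using assms(2)[of "Max S" i] Max_in[OF fin False] by (cases "i = Max S") auto
  qed (use fin assms(1) in auto)
  moreover have "Max S \<le> h"
    using Max_in[OF fin False] assms(1) by auto
  ultimately show ?thesis by blast
qed

text \<open>Termination of the loop gives nonzero weights and pairs distinct up to sign; negation
  turns this into positive input weights and distinct pairs; sorting moves the eliminated units,
  which are zero, to the end.\<close>

lemma canonicalise_reduced:
  assumes "canonicalise h w v"
  shows "nn_fun h v = nn_fun h w" and "\<exists>r. reduced h v r"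
proof -
  obtain w' Z \<pi> where steps: "(reduce_step h)\<^sup>*\<^sup>* (w, {}) (w', Z)"
    and stop: "\<nexists>s. reduce_step h (w', Z) s"
    and sort: "sorting_perm h (negate_units h Z w') \<pi>"
    and v: "v = permute_units \<pi> (negate_units h Z w')"
    using assms unfolding canonicalise_def by blast
  define u where "u = negate_units h Z w'"
  have perm: "\<pi> permutes {1..h}"
    using sort by (simp add: sorting_perm_def)
  have inv: "nn_fun h w' = nn_fun h w" "\<And>i. i \<in> Z \<Longrightarrow> pa w' i = 0 \<and> pb w' i = 0 \<and> pc w' i = 0"
    using reduce_steps_invariant[OF steps] by auto
  note alive = reduce_step_terminal[OF stop]
  show "nn_fun h v = nn_fun h w"
    unfolding v nn_fun_permute_units[OF perm] inv(1)[symmetric]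
    by (rule nn_fun_negate_units) (rule alive(2))
  have u_alive: "pa u i \<noteq> 0" "pb u i > 0" if "i \<in> {1..h} - Z" for i
    using alive[OF that] that by (auto simp: u_def negate_units_def sgn_real_def)
  have u_dead: "pa u i = 0 \<and> pb u i = 0 \<and> pc u i = 0" if "i \<in> Z" for i
    using inv(2)[OF that] that by (auto simp: u_def negate_units_def)
  \<comment> \<open>If two negated pairs agree, the original pairs were equal or opposite.\<close>
  have u_inj: "(pb u i, pc u i) \<noteq> (pb u j, pc u j)"
    if "i \<in> {1..h} - Z" "j \<in> {1..h} - Z" "i \<noteq> j" for i j
  proof -
    have "- pb w' i = pb w' j \<Longrightarrow> - pc w' i \<noteq> pc w' j" "pb w' i = - pb w' j \<Longrightarrow> pc w' i \<noteq> - pc w' j"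
      "pb w' i = pb w' j \<Longrightarrow> pc w' i \<noteq> pc w' j"
      using alive(3)[OF that] by (auto simp: minus_equation_iff[of "pb w' i"] minus_equation_iff[of "pc w' i"])
    then show ?thesis
      using alive(2)[OF that(1)] alive(2)[OF that(2)] that
      by (auto simp: u_def negate_units_def sgn_real_def split: if_splits)
  qed
  have v_u: "pa v i = pa u (\<pi> i)" "pb v i = pb u (\<pi> i)" "pc v i = pc u (\<pi> i)" for i
    by (simp_all add: v u_def permute_units_def)
  \<comment> \<open>The positions that hold a surviving unit after sorting. They are those of
    positive input weight, so the decreasing order makes them an initial segment.\<close>
  define S where "S = {i \<in> {1..h}. \<pi> i \<notin> Z}"
  have S_iff: "i \<in> S \<longleftrightarrow> pb v i > 0" if "i \<in> {1..h}" for i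
    using that u_alive(2)[of "\<pi> i"] u_dead[of "\<pi> i"] permutes_in_image[OF perm, of i]
    by (auto simp: S_def v_u)
  have "\<exists>r\<le>h. S = {1..r}"
  proof (rule downward_closed_eq_atMost)
    fix i j assume "j \<in> S" "1 \<le> i" "i < j"
    then have ij: "i \<in> {1..h}" "j \<in> {1..h}" by (auto simp: S_def)
    then have "pb v i \<ge> pb v j"
      using sort \<open>i < j\<close> by (fastforce simp: sorting_perm_def v_u u_def)
    then show "i \<in> S"
      using S_iff ij \<open>j \<in> S\<close> by fastforce
  qed (auto simp: S_def)
  then obtain r where r: "r \<le> h" "S = {1..r}" by blast
  have pi_alive: "\<pi> i \<in> {1..h} - Z" if "i \<in> {1..r}" for i
  proof -
    have "i \<in> S" using that r(2) by blast
    then show ?thesis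
      using permutes_in_image[OF perm, of i] unfolding S_def by blast
  qed
  have "inj_on (\<lambda>i. (pb v i, pc v i)) {1..r}"
  proof (rule inj_onI)
    fix i j assume "i \<in> {1..r}" "j \<in> {1..r}" "(pb v i, pc v i) = (pb v j, pc v j)"
    then have "\<pi> i = \<pi> j"
      using u_inj[OF pi_alive pi_alive, of i j] by (auto simp: v_u)
    then show "i = j"
      using permutes_inj[OF perm] by (auto dest: injD)
  qed
  moreover have "\<pi> i \<in> Z" if "i \<in> {r + 1..h}" for i
  proof -
    have "i \<notin> S" using that r(2) by auto
    then show ?thesis using that by (auto simp: S_def)
  qed
  ultimately have "reduced h v r"
    using r(1) u_alive[OF pi_alive] u_dead unfolding reduced_def v_u by blast
  then show "\<exists>r. reduced h v r" ..
qed

section \<open>Coefficients determined by the network function\<close>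

text \<open>Unlike \<open>sgn\<close> this is 1 at input weight zero, so that it always yields a
  sign vector admissible in \<open>canon_traces\<close>.\<close>

definition unit_sign :: "param \<Rightarrow> nat \<Rightarrow> real" where
  "unit_sign w i = (if pb w i < 0 then -1 else 1)"

definition unit_key :: "param \<Rightarrow> nat \<Rightarrow> real \<times> real" where
  "unit_key w i = (unit_sign w i * pb w i, unit_sign w i * pc w i)"

definition active :: "nat \<Rightarrow> param \<Rightarrow> nat set" where
  "active h w = {i \<in> {1..h}. pb w i \<noteq> 0}"

text \<open>The coefficient of \<open>tanh (fst p * x + snd p)\<close> in the network function, once
  units are flipped to positive input weight and like terms are collected; \<open>bias\<close> is
  the constant term of that expansion.\<close>

definition weight :: "nat \<Rightarrow> param \<Rightarrow> real \<times> real \<Rightarrow> real" where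
  "weight h w p = (\<Sum>i | i \<in> active h w \<and> unit_key w i = p. unit_sign w i * pa w i)"

definition bias :: "nat \<Rightarrow> param \<Rightarrow> real" where
  "bias h w = pd w + (\<Sum>i | i \<in> {1..h} \<and> pb w i = 0. pa w i * tanh (pc w i))"

lemma finite_active [simp]: "finite (active h w)"
  by (simp add: active_def)

lemma unit_key_pos: "i \<in> active h w \<Longrightarrow> fst (unit_key w i) > 0"
  by (auto simp: active_def unit_key_def unit_sign_def)

lemma weight_eq_0: "p \<notin> unit_key w ` active h w \<Longrightarrow> weight h w p = 0"
  unfolding weight_def by (rule sum.neutral) auto

text \<open>\<open>P\<close> may exceed the set of keys of \<open>w\<close>, so that two networks
  can be expanded over a common set.\<close>

lemma nn_fun_eq_weights:
  assumes "finite P" "unit_key w ` active h w \<subseteq> P"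
  shows "nn_fun h w x = bias h w + (\<Sum>p\<in>P. weight h w p * tanh (fst p * x + snd p))"
proof -
  let ?g = "\<lambda>i. pa w i * tanh (pb w i * x + pc w i)"
  have split: "{1..h} = {i. i \<in> {1..h} \<and> pb w i = 0} \<union> active h w"
    by (auto simp: active_def)
  have "sum ?g {1..h} = sum ?g {i. i \<in> {1..h} \<and> pb w i = 0} + sum ?g (active h w)"
    by (subst split, rule sum.union_disjoint) (auto simp: active_def)
  also have "sum ?g {i. i \<in> {1..h} \<and> pb w i = 0} = (\<Sum>i | i \<in> {1..h} \<and> pb w i = 0. pa w i * tanh (pc w i))"
    by (rule sum.cong) auto
  also have "sum ?g (active h w) = (\<Sum>p\<in>P. sum ?g {i. i \<in> active h w \<and> unit_key w i = p})"
    using assms by (simp add: sum.group)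
  also have "\<dots> = (\<Sum>p\<in>P. weight h w p * tanh (fst p * x + snd p))"
  proof (intro sum.cong refl)
    fix p
    have "?g i = unit_sign w i * pa w i * tanh (fst p * x + snd p)" if "unit_key w i = p" for i
      using tanh_sign[of "unit_sign w i" "pa w i" "pb w i" x "pc w i"] that
      by (auto simp: unit_key_def unit_sign_def)
    then show "sum ?g {i. i \<in> active h w \<and> unit_key w i = p} = weight h w p * tanh (fst p * x + snd p)"
      unfolding weight_def sum_distrib_right by (intro sum.cong) auto
  qed
  finally show ?thesis
    by (simp add: nn_fun_def bias_def)
qed

text \<open>Independence is applied to the difference of the two expansions over the union of the
  keys; off that union both weights vanish. The numbers of units may differ, as the rank
  requires.\<close>

lemma nn_fun_eq_imp:
  assumes "nn_fun h w = nn_fun h' w'"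
  shows "weight h w = weight h' w'" and "bias h w = bias h' w'"
proof -
  define P where "P = unit_key w ` active h w \<union> unit_key w' ` active h' w'"
  have fin: "finite P" by (simp add: P_def)
  have pos: "fst p > 0" if "p \<in> P" for p
    using that unit_key_pos by (auto simp: P_def)
  have eq: "(bias h w - bias h' w') + (\<Sum>p\<in>P. (weight h w p - weight h' w' p) * tanh (fst p * x + snd p)) = 0" for x
    using nn_fun_eq_weights[OF fin, of w h x] nn_fun_eq_weights[OF fin, of w' h' x] fun_cong[OF assms, of x]
    by (simp add: P_def left_diff_distrib sum_subtractf)
  note ind = tanh_independent[OF fin pos eq]
  show "bias h w = bias h' w'"
    using ind(2) by simp
  show "weight h w = weight h' w'"
  proof
    fix p
    show "weight h w p = weight h' w' p"
    proof (cases "p \<in> P")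
      case True
      then show ?thesis using ind(1) by simp
    next
      case False
      then show ?thesis by (simp add: P_def weight_eq_0)
    qed
  qed
qed

section \<open>Coefficients of a reduced parameter, and the rank\<close>

lemma reduced_bias:
  assumes "reduced h v r"
  shows "bias h v = pd v"
proof -
  have "pa v i = 0" if "i \<in> {1..h}" "pb v i = 0" for i
  proof (cases "i \<in> {1..r}")
    case True
    then show ?thesis
      using assms that(2) by (force simp: reduced_def)
  next
    case False
    then have "i \<in> {r + 1..h}" using that(1) by auto
    then show ?thesis
      using assms unfolding reduced_def by blast
  qed
  then have "(\<Sum>i | i \<in> {1..h} \<and> pb v i = 0. pa v i * tanh (pc v i)) = 0"
    by (intro sum.neutral) auto
  then show ?thesis
    by (simp add: bias_def)
qed

lemma reduced_unit_key:
  assumes "reduced h v r" "i \<in> {1..r}"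
  shows "i \<in> active h v" "unit_key v i = (pb v i, pc v i)" "unit_sign v i = 1"
proof -
  have "pb v i > 0" "r \<le> h" using assms by (auto simp: reduced_def)
  with assms(2) show "i \<in> active h v" "unit_key v i = (pb v i, pc v i)" "unit_sign v i = 1"
    by (auto simp: active_def unit_key_def unit_sign_def)
qed

lemma reduced_active:
  assumes "reduced h v r"
  shows "active h v = {1..r}"
proof (intro set_eqI iffI)
  fix i assume i: "i \<in> active h v"
  show "i \<in> {1..r}"
  proof (rule ccontr)
    assume "i \<notin> {1..r}"
    then have "i \<in> {r + 1..h}" using i by (auto simp: active_def)
    then show False using assms i by (auto simp: reduced_def active_def)
  qed
qed (use reduced_unit_key(1)[OF assms] in blast)

text \<open>The pairs of the first \<open>r\<close> units are distinct, so the group of units with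
  this key is the single unit \<open>i\<close>.\<close>

lemma reduced_weight:
  assumes "reduced h v r" "i \<in> {1..r}"
  shows "weight h v (pb v i, pc v i) = pa v i"
proof -
  have "{j. j \<in> active h v \<and> unit_key v j = (pb v i, pc v i)} = {i}"
    using assms(2) reduced_unit_key(2)[OF assms(1)]
      inj_on_eq_iff[of "\<lambda>i. (pb v i, pc v i)" "{1..r}" _ i] assms(1)
    unfolding reduced_active[OF assms(1)] reduced_def by auto
  then show ?thesis
    using reduced_unit_key(3)[OF assms] by (simp add: weight_def)
qed

text \<open>A nonzero coefficient needs at least one unit carrying its key. This gives the lower
  bound on the rank and later makes the trace hit all of \<open>{1..r}\<close>.\<close>

lemma reduced_keys:
  assumes red: "reduced h v r" and eq: "nn_fun h v = nn_fun h' w"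
  shows "(\<lambda>i. (pb v i, pc v i)) ` {1..r} \<subseteq> unit_key w ` active h' w"
proof clarify
  fix i assume i: "i \<in> {1..r}"
  have "weight h' w (pb v i, pc v i) = pa v i"
    using nn_fun_eq_imp(1)[OF eq] reduced_weight[OF red i] by simp
  also have "\<dots> \<noteq> 0"
    using red i by (simp add: reduced_def)
  finally show "(pb v i, pc v i) \<in> unit_key w ` active h' w"
    using weight_eq_0 by blast
qed

lemma card_active_le: "card (unit_key w ` active h w) \<le> h"
proof -
  have "card (unit_key w ` active h w) \<le> card (active h w)"
    by (simp add: card_image_le)
  also have "\<dots> \<le> card {1..h}"
    by (rule card_mono) (auto simp: active_def)
  finally show ?thesis by simp
qed

lemma nn_rank_reduced:
  assumes red: "reduced h v r" and eq: "nn_fun h v = nn_fun h w"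
  shows "nn_rank h w = r"
  unfolding nn_rank_def
proof (rule Least_equality)
  \<comment> \<open>The first \<open>r\<close> units of \<open>v\<close> realise the function;
    \<open>restrict\<close> makes the truncation an element of \<open>param_space r\<close>.\<close>
  define u where "u = v\<lparr>pa := restrict (pa v) {1..r}, pb := restrict (pb v) {1..r}, pc := restrict (pc v) {1..r}\<rparr>"
  have "nn_fun h v x = nn_fun r u x" for x
  proof -
    have "(\<Sum>i = 1..h. pa v i * tanh (pb v i * x + pc v i))
        = (\<Sum>i = 1..r. pa v i * tanh (pb v i * x + pc v i))"
      using red by (intro sum.mono_neutral_right) (auto simp: reduced_def)
    also have "\<dots> = (\<Sum>i = 1..r. pa u i * tanh (pb u i * x + pc u i))"
      by (intro sum.cong) (auto simp: u_def)
    finally show ?thesis by (simp add: nn_fun_def u_def)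
  qed
  moreover have "u \<in> param_space r"
    by (simp add: param_space_def u_def)
  ultimately show "\<exists>w'\<in>param_space r. nn_fun h w = nn_fun r w'"
    using eq by auto
next
  fix h' assume "\<exists>w'\<in>param_space h'. nn_fun h w = nn_fun h' w'"
  then obtain w' where "nn_fun h v = nn_fun h' w'"
    using eq by auto
  note sub = reduced_keys[OF red this]
  have "r = card ((\<lambda>i. (pb v i, pc v i)) ` {1..r})"
    using red by (simp add: reduced_def card_image)
  also have "\<dots> \<le> card (unit_key w' ` active h' w')"
    using sub by (intro card_mono) auto
  also have "\<dots> \<le> h'" by (rule card_active_le)
  finally show "r \<le> h'" .
qed

section \<open>Traces\<close>

text \<open>Group the units by their value under \<open>\<tau>\<close>: fibre 0 contributes to the
  constant, a fibre up to \<open>r\<close> collapses to one unit of \<open>v\<close>, and the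
  remaining fibres cancel.\<close>

lemma nn_fun_of_trace:
  assumes red: "reduced h v r" and tr: "(\<sigma>, \<tau>) \<in> canon_traces h r"
    and X: "w \<in> X_set h (pd v) (trace_fibre h \<tau> 0)"
    and Y: "\<And>j. j \<in> {1..r} \<Longrightarrow> w \<in> Y_set h (pa v j) (pb v j) (pc v j) \<sigma> (trace_fibre h \<tau> j)"
    and Z: "\<And>j. j \<in> {r + 1..h} \<Longrightarrow> w \<in> Z_set h \<sigma> (trace_fibre h \<tau> j)"
  shows "nn_fun h w = nn_fun h v"
proof
  fix x
  let ?g = "\<lambda>i. pa w i * tanh (pb w i * x + pc w i)"
  have sg: "?g i = \<sigma> i * pa w i * tanh (\<sigma> i * pb w i * x + \<sigma> i * pc w i)" if "i \<in> {1..h}" for i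
  proof -
    have "\<sigma> i \<in> {-1, 1}"
      using tr that by (auto simp: canon_traces_def)
    then show ?thesis by (simp only: tanh_sign)
  qed
  have common: "sum ?g I = (\<Sum>i\<in>I. \<sigma> i * pa w i) * tanh (\<beta> * x + \<gamma>)"
    if "I \<subseteq> {1..h}" "\<And>i. i \<in> I \<Longrightarrow> \<sigma> i * pb w i = \<beta> \<and> \<sigma> i * pc w i = \<gamma>" for I \<beta> \<gamma>
    unfolding sum_distrib_right
  proof (rule sum.cong)
    fix i assume "i \<in> I"
    then have "i \<in> {1..h}" "\<sigma> i * pb w i = \<beta>" "\<sigma> i * pc w i = \<gamma>"
      using that by auto
    then show "?g i = \<sigma> i * pa w i * tanh (\<beta> * x + \<gamma>)"
      using sg[of i] by simp
  qed simp
  have sub: "trace_fibre h \<tau> j \<subseteq> {1..h}" for j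
    by (auto simp: trace_fibre_def)
  \<comment> \<open>Units of \<open>v\<close> above \<open>r\<close> are zero, so cancelling fibres
    match them and one formula covers all \<open>j\<close>.\<close>
  have fibre: "sum ?g (trace_fibre h \<tau> j) = pa v j * tanh (pb v j * x + pc v j)" if j: "j \<in> {1..h}" for j
  proof (cases "j \<in> {1..r}")
    case True
    then show ?thesis
      using Y[OF True] common[OF sub, of j "pb v j" "pc v j"] by (simp add: Y_set_def)
  next
    case False
    then have j': "j \<in> {r + 1..h}" using j by auto
    have "sum ?g (trace_fibre h \<tau> j) = 0"
    \<comment> \<open>A nonempty fibre supplies the common pair from any of its members.\<close>
    proof (cases "trace_fibre h \<tau> j = {}")
      case True
      then show ?thesis by (simp only: sum.empty)
    next
      case False
      then obtain k where k: "k \<in> trace_fibre h \<tau> j" by blast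
      have "\<sigma> i * pb w i = \<sigma> k * pb w k \<and> \<sigma> i * pc w i = \<sigma> k * pc w k"
        if "i \<in> trace_fibre h \<tau> j" for i
        using Z[OF j'] that k unfolding Z_set_def by blast
      then have "sum ?g (trace_fibre h \<tau> j)
          = (\<Sum>i\<in>trace_fibre h \<tau> j. \<sigma> i * pa w i) * tanh (\<sigma> k * pb w k * x + \<sigma> k * pc w k)"
        by (rule common[OF sub])
      then show ?thesis
        using Z[OF j'] by (simp add: Z_set_def)
    qed
    then show ?thesis
      using red j' by (simp add: reduced_def)
  qed
  have "sum ?g {1..h} = (\<Sum>j\<in>{0..h}. sum ?g (trace_fibre h \<tau> j))"
  proof -
    have "\<tau> ` {1..h} \<subseteq> {0..h}"
      using tr unfolding canon_traces_def by blast
    then show ?thesis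
      unfolding trace_fibre_def by (simp only: sum.group finite_atLeastAtMost)
  qed
  also have "\<dots> = sum ?g (trace_fibre h \<tau> 0) + (\<Sum>j\<in>{1..h}. sum ?g (trace_fibre h \<tau> j))"
    by (simp add: sum.atLeast_Suc_atMost)
  also have "sum ?g (trace_fibre h \<tau> 0) = (\<Sum>i\<in>trace_fibre h \<tau> 0. pa w i * tanh (pc w i))"
    using X by (intro sum.cong) (auto simp: X_set_def)
  also have "(\<Sum>j\<in>{1..h}. sum ?g (trace_fibre h \<tau> j)) = (\<Sum>j = 1..h. pa v j * tanh (pb v j * x + pc v j))"
    using fibre by (intro sum.cong) auto
  finally show "nn_fun h w x = nn_fun h v x"
    using X by (simp add: nn_fun_def X_set_def)
qed

text \<open>The trace is read off from \<open>w\<close>: signs from \<open>unit_sign\<close>, value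
  0 for units with zero input weight, and otherwise an index that encodes the key
  injectively.\<close>

lemma trace_of_nn_fun:
  assumes red: "reduced h v r" and w: "w \<in> param_space h" and eq: "nn_fun h v = nn_fun h w"
  obtains \<sigma> \<tau> where "(\<sigma>, \<tau>) \<in> canon_traces h r"
    and "w \<in> X_set h (pd v) (trace_fibre h \<tau> 0)"
    and "\<And>j. j \<in> {1..r} \<Longrightarrow> w \<in> Y_set h (pa v j) (pb v j) (pc v j) \<sigma> (trace_fibre h \<tau> j)"
    and "\<And>j. j \<in> {r + 1..h} \<Longrightarrow> w \<in> Z_set h \<sigma> (trace_fibre h \<tau> j)"
proof -
  define key where "key = (\<lambda>i. (pb v i, pc v i))"
  define K where "K = unit_key w ` active h w"
  have inj: "inj_on key {1..r}" and rh: "r \<le> h"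
    using red by (simp_all add: reduced_def key_def)
  have sub: "key ` {1..r} \<subseteq> K"
    using reduced_keys[OF red eq] by (simp add: key_def K_def)
  have finK: "finite K" by (simp add: K_def)
  \<comment> \<open>There are at most \<open>h\<close> keys and \<open>r\<close> of them are
    canonical, so the indices above \<open>r\<close> suffice for the others.\<close>
  have "card (K - key ` {1..r}) = card K - r"
    using sub inj by (simp add: card_Diff_subset card_image)
  also have "\<dots> \<le> card {r + 1..h}"
    using card_active_le[of w h] by (simp add: K_def)
  finally obtain f where f: "f ` (K - key ` {1..r}) \<subseteq> {r + 1..h}" "inj_on f (K - key ` {1..r})"
    using card_le_inj[of "K - key ` {1..r}" "{r + 1..h}"] finK by auto
  \<comment> \<open>Pairs of the canonical form keep their index there; all others get distinct indices above \<open>r\<close>.\<close>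
  define idx where "idx p = (if p \<in> key ` {1..r} then the_inv_into {1..r} key p else f p)" for p
  have idx_key: "idx (key j) = j" if "j \<in> {1..r}" for j
    using that inj by (simp add: idx_def the_inv_into_f_f)
  have idx_other: "idx p \<in> {r + 1..h}" if "p \<in> K - key ` {1..r}" for p
    using that f(1) by (auto simp: idx_def)
  have idx_range: "idx p \<in> {1..h}" if "p \<in> K" for p
    using that idx_key idx_other[of p] rh by (cases "p \<in> key ` {1..r}") auto
  have idx_inj: "inj_on idx K"
  proof (rule inj_onI)
    fix p q assume pq: "p \<in> K" "q \<in> K" "idx p = idx q"
    show "p = q"
    proof (cases "p \<in> key ` {1..r}"; cases "q \<in> key ` {1..r}")
      assume "p \<notin> key ` {1..r}" "q \<notin> key ` {1..r}"
      then show ?thesis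
        using pq f(2) by (auto simp: idx_def dest: inj_onD)
    qed (use pq idx_key idx_other[of p] idx_other[of q] in auto)
  qed
  define \<tau> where "\<tau> = restrict (\<lambda>i. if pb w i = 0 then 0 else idx (unit_key w i)) {1..h}"
  define \<sigma> where "\<sigma> = restrict (unit_sign w) {1..h}"
  have tau: "\<tau> i = idx (unit_key w i)" "unit_key w i \<in> K" if "i \<in> active h w" for i
    using that by (auto simp: \<tau>_def active_def K_def)
  have fibre0: "trace_fibre h \<tau> 0 = {i. i \<in> {1..h} \<and> pb w i = 0}"
    using tau idx_range by (fastforce simp: trace_fibre_def \<tau>_def active_def)
  have fibre: "trace_fibre h \<tau> j = {i. i \<in> active h w \<and> idx (unit_key w i) = j}" if "j \<ge> 1" for j
    using that by (auto simp: trace_fibre_def \<tau>_def active_def)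
  \<comment> \<open>Injectivity of \<open>idx\<close> makes each fibre exactly one group of units
    with the same key, so the signed sum over it is a \<open>weight\<close>, which \<open>v\<close>
    shares.\<close>
  have fibre_key: "trace_fibre h \<tau> (idx p) = {i. i \<in> active h w \<and> unit_key w i = p}" if "p \<in> K" for p
    using fibre[of "idx p"] idx_range[OF that] tau(2) that idx_inj by (auto dest: inj_onD)
  have sig: "\<sigma> i * pa w i = unit_sign w i * pa w i" "\<sigma> i * pb w i = fst (unit_key w i)"
    "\<sigma> i * pc w i = snd (unit_key w i)"
    if "i \<in> active h w" for i
    using that by (auto simp: \<sigma>_def active_def unit_key_def)
  have sum_key: "(\<Sum>i\<in>trace_fibre h \<tau> (idx p). \<sigma> i * pa w i) = weight h v p" if "p \<in> K" for p
    unfolding nn_fun_eq_imp(1)[OF eq] weight_def fibre_key[OF that]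
    by (intro sum.cong refl sig) auto
  show ?thesis
  proof
    have "{1..r} \<subseteq> \<tau> ` {1..h}"
    proof
      fix j assume j: "j \<in> {1..r}"
      then obtain i where i: "i \<in> active h w" "unit_key w i = key j"
        using sub by (force simp: K_def)
      then have "\<tau> i = j" "i \<in> {1..h}"
        using tau(1) idx_key[OF j] by (auto simp: active_def)
      then show "j \<in> \<tau> ` {1..h}" by blast
    qed
    moreover have "\<tau> i \<in> {0..h}" if "i \<in> {1..h}" for i
      using that idx_range[of "unit_key w i"] by (auto simp: \<tau>_def K_def active_def)
    ultimately show "(\<sigma>, \<tau>) \<in> canon_traces h r"
      by (auto simp: canon_traces_def \<sigma>_def \<tau>_def unit_sign_def)
  next
    show "w \<in> X_set h (pd v) (trace_fibre h \<tau> 0)"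
      using w nn_fun_eq_imp(2)[OF eq] reduced_bias[OF red]
      by (auto simp: X_set_def fibre0 bias_def)
  next
    fix j assume j: "j \<in> {1..r}"
    then have p: "key j \<in> K" using sub by blast
    show "w \<in> Y_set h (pa v j) (pb v j) (pc v j) \<sigma> (trace_fibre h \<tau> j)"
      using w sum_key[OF p] fibre_key[OF p] sig(2,3) reduced_weight[OF red j] idx_key[OF j]
      unfolding Y_set_def key_def by simp
  next
    fix j assume j: "j \<in> {r + 1..h}"
    show "w \<in> Z_set h \<sigma> (trace_fibre h \<tau> j)"
    proof (cases "j \<in> idx ` K")
      case False
      then have "trace_fibre h \<tau> j = {}"
        using j fibre tau(2) by auto
      then show ?thesis using w by (simp add: Z_set_def)
    next
      case True
      then obtain p where p: "p \<in> K" "j = idx p" by blast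
      \<comment> \<open>An index above \<open>r\<close> belongs to a key absent from
        \<open>v\<close>, whose coefficient is therefore zero.\<close>
      have "p \<notin> key ` {1..r}"
        using idx_key j p by auto
      then have "weight h v p = 0"
        using reduced_unit_key(2)[OF red]
        by (intro weight_eq_0) (auto simp: reduced_active[OF red] key_def)
      then show ?thesis
        using w sum_key[OF p(1)] fibre_key[OF p(1)] sig(2,3) p(2)
        by (auto simp: Z_set_def)
    qed
  qed
qed

theorem theorem5p2:
  fixes h r :: nat and w v :: param
  assumes "w \<in> param_space h"
    and "canonicalise h w v"
    and "r = nn_rank h w"
  shows "fun_equiv_class h w =
    (\<Union>(\<sigma>, \<tau>) \<in> canon_traces h r.
       X_set h (pd v) (trace_fibre h \<tau> 0) \<inter>
       (\<Inter>i \<in> {1..r}. Y_set h (pa v i) (pb v i) (pc v i) \<sigma> (trace_fibre h \<tau> i)) \<inter>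
       (\<Inter>i \<in> {r + 1..h}. Z_set h \<sigma> (trace_fibre h \<tau> i)))"
    (is "_ = ?U")
proof (intro set_eqI iffI)
  have eq: "nn_fun h v = nn_fun h w"
    by (rule canonicalise_reduced(1)[OF assms(2)])
  \<comment> \<open>The number of nonzero units left by the procedure is identified with the
    rank.\<close>
  obtain r' where r': "reduced h v r'"
    using canonicalise_reduced(2)[OF assms(2)] ..
  then have red: "reduced h v r"
    using nn_rank_reduced[OF r' eq] assms(3) by simp
  fix w'
  show "w' \<in> ?U" if "w' \<in> fun_equiv_class h w"
  proof -
    have "w' \<in> param_space h" "nn_fun h v = nn_fun h w'"
      using that eq by (auto simp: fun_equiv_class_def)
    then show ?thesis
    proof (rule trace_of_nn_fun[OF red])
      fix \<sigma> \<tau>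
      assume tr: "(\<sigma>, \<tau>) \<in> canon_traces h r"
        and "w' \<in> X_set h (pd v) (trace_fibre h \<tau> 0)"
        and "\<And>j. j \<in> {1..r} \<Longrightarrow> w' \<in> Y_set h (pa v j) (pb v j) (pc v j) \<sigma> (trace_fibre h \<tau> j)"
        and "\<And>j. j \<in> {r + 1..h} \<Longrightarrow> w' \<in> Z_set h \<sigma> (trace_fibre h \<tau> j)"
      then have "w' \<in> (case (\<sigma>, \<tau>) of (\<sigma>, \<tau>) \<Rightarrow>
         X_set h (pd v) (trace_fibre h \<tau> 0) \<inter>
         (\<Inter>i \<in> {1..r}. Y_set h (pa v i) (pb v i) (pc v i) \<sigma> (trace_fibre h \<tau> i)) \<inter>
         (\<Inter>i \<in> {r + 1..h}. Z_set h \<sigma> (trace_fibre h \<tau> i)))"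
        by simp
      then show "w' \<in> ?U"
        by (rule UN_I[OF tr])
    qed
  qed
  show "w' \<in> fun_equiv_class h w" if "w' \<in> ?U"
  proof -
    from that obtain \<sigma> \<tau> where tr: "(\<sigma>, \<tau>) \<in> canon_traces h r"
      and XYZ: "w' \<in> X_set h (pd v) (trace_fibre h \<tau> 0) \<inter>
       (\<Inter>i \<in> {1..r}. Y_set h (pa v i) (pb v i) (pc v i) \<sigma> (trace_fibre h \<tau> i)) \<inter>
       (\<Inter>i \<in> {r + 1..h}. Z_set h \<sigma> (trace_fibre h \<tau> i))"
      by (elim UN_E) (simp only: split_paired_all prod.case)
    then have "nn_fun h w' = nn_fun h v"
      by (intro nn_fun_of_trace[OF red tr]) simp_all
    then show ?thesis
      using XYZ eq by (simp add: fun_equiv_class_def X_set_def)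
  qed
qed

end
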